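(* For any $k\in \mathbb N^*$, we have \begin{equation} \mathfrak m_k (3) \geq \overline{m} (k, \mathfrak A_3^{har}) \,. \end{equation}
   Context: For $N\in\mathbb N^*=\mathbb N\setminus\{0\}$, let $\mathfrak M(N)$ be the family of arrays $\mathfrak A=(a^n_i)$ with $N$ rows, each row an infinite strictly increasing sequence of reals. The spectrum of $\mathfrak A$ is the set of all sums $\lambda=\sum_{n=1}^N a^n_{j_n}$ with $(j_1,\dots,j_N)\in(\mathbb N^* )^N$, and the multiplicity of $\lambda$ is the number of such $N$-tuples representing it. Ordering the spectrum as a non-decreasing sequence $\lambda_1(\mathfrak A)\le\lambda_2(\mathfrak A)\le\dots$ counted with multiplicity, set $m(k,\mathfrak A)$ = multiplicity of $\lambda_k(\mathfrak A)$ and $\mathfrak m_k(N)=\sup_{\mathfrak A\in\mathfrak M(N)} m(k,\mathfrak A)$. $\mathfrak A_3^{har}$ is the array with three rows each equal to $0,1,2,3,\dots$; its eigenvalue $j\in\mathbb N$ has multiplicity $m(k_{min}(j),\mathfrak A_3^{har})=\frac{(j+1)(j+2)}{2}$ and smallest label $k_{min}(j)=1+\frac{j(j+1)(j+2)}{6}$. With $c(\ell)=\ell(\ell+1)/2$, for $j\in\mathbb N$, $\ell=0,\dots,j$ and $k\in\mathbb N^*$ in the interval $I_{j,\ell}=[k_{min}(j)+c(j+1)-c(j+1-\ell),\,k_{min}(j)+c(j+1)-c(j-\ell))$, define $\overline m(k,\mathfrak A_3^{har})=m(k_{min}(j),\mathfrak A_3^{har})+\ell=\frac{(j+1)(j+2)}{2}+\ell$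 (these intervals partition $\mathbb N^*$). *)

theory Defs
  imports Complex_Main "HOL-Library.FuncSet" "HOL-Library.Extended_Nat" "HOL-Library.Infinite_Set"
begin

text \<open>
  An array with \<open>N\<close> rows is a function \<open>a :: nat \<Rightarrow> nat \<Rightarrow> real\<close>, where \<open>a n i\<close> is the \<open>i\<close>-th entry of
  the \<open>n\<close>-th row. Rows are indexed by \<open>{1..N}\<close>, and columns and labels by the positive naturals
  \<open>{1..}\<close>; values of \<open>a\<close> at other indices are irrelevant. Rows may be bounded.
\<close>

definition arrays :: "nat \<Rightarrow> (nat \<Rightarrow> nat \<Rightarrow> real) set" where
  "arrays N = {a. \<forall>n\<in>{1..N}. strict_mono_on {1..} (a n)}"

definition tuples :: "nat \<Rightarrow> (nat \<Rightarrow> nat) set" where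
  "tuples N = {1..N} \<rightarrow>\<^sub>E {1..}"

definition tuple_sum :: "nat \<Rightarrow> (nat \<Rightarrow> nat \<Rightarrow> real) \<Rightarrow> (nat \<Rightarrow> nat) \<Rightarrow> real" where
  "tuple_sum N a j = (\<Sum>n\<in>{1..N}. a n (j n))"

definition spectrum :: "nat \<Rightarrow> (nat \<Rightarrow> nat \<Rightarrow> real) \<Rightarrow> real set" where
  "spectrum N a = tuple_sum N a ` tuples N"

text \<open>Lemma \<open>finite_level\<close> below shows that the set counted here is finite.\<close>

definition multiplicity :: "nat \<Rightarrow> (nat \<Rightarrow> nat \<Rightarrow> real) \<Rightarrow> real \<Rightarrow> nat" where
  "multiplicity N a x = card {j \<in> tuples N. tuple_sum N a j = x}"

text \<open>
  \<open>ordered_spectrum N a s\<close>: the sequence \<open>s 1 \<le> s 2 \<le> \<dots>\<close> lists the spectrum in non-decreasing order,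
  each value being repeated according to its multiplicity. When some row is bounded, the spectrum
  may have order type greater than \<open>\<omega>\<close>; then \<open>s\<close> lists its first \<open>\<omega>\<close> values, and the
  last conjunct says that every value not listed lies above all listed ones.
  Lemmas \<open>ordered_spectrum_exists\<close> and \<open>ordered_spectrum_unique\<close> show that \<open>s\<close> exists and that
  its values on \<open>{1..}\<close> are unique.
\<close>

definition ordered_spectrum :: "nat \<Rightarrow> (nat \<Rightarrow> nat \<Rightarrow> real) \<Rightarrow> (nat \<Rightarrow> real) \<Rightarrow> bool" where
  "ordered_spectrum N a s \<longleftrightarrow>
     mono_on {1..} s \<and>
     s ` {1..} \<subseteq> spectrum N a \<and>
     (\<forall>x \<in> s ` {1..}. card {k \<in> {1..}. s k = x} = multiplicity N a x) \<and>
     (\<forall>x \<in> spectrum N a - s ` {1..}. \<forall>k \<ge> 1. s k < x)"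

definition eigenvalue :: "nat \<Rightarrow> (nat \<Rightarrow> nat \<Rightarrow> real) \<Rightarrow> nat \<Rightarrow> real" where
  "eigenvalue N a k = (THE x. \<exists>s. ordered_spectrum N a s \<and> x = s k)"

definition label_mult :: "nat \<Rightarrow> (nat \<Rightarrow> nat \<Rightarrow> real) \<Rightarrow> nat \<Rightarrow> nat" where
  "label_mult N a k = multiplicity N a (eigenvalue N a k)"

text \<open>The supremum is taken in \<^typ>\<open>enat\<close>, so that no boundedness is presupposed.\<close>

definition max_mult :: "nat \<Rightarrow> nat \<Rightarrow> enat" where
  "max_mult k N = (SUP a \<in> arrays N. enat (label_mult N a k))"

text \<open>Every row is \<open>0, 1, 2, \<dots>\<close>; the shift by one comes from columns being numbered from 1.\<close>

definition har :: "nat \<Rightarrow> nat \<Rightarrow> real" where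
  "har n i = real i - 1"

text \<open>The smallest label of the eigenvalue \<open>j\<close>; its value is \<open>1 + j (j + 1) (j + 2) / 6\<close>.\<close>

definition k_min :: "nat \<Rightarrow> nat" where
  "k_min j = (LEAST k. k \<ge> 1 \<and> eigenvalue 3 har k = real j)"

definition triangle :: "nat \<Rightarrow> nat" where
  "triangle l = l * (l + 1) div 2"

text \<open>For \<open>l \<le> j\<close> none of the subtractions on \<^typ>\<open>nat\<close> below is truncated.\<close>

definition label_interval :: "nat \<Rightarrow> nat \<Rightarrow> nat set" where
  "label_interval j l =
     {k_min j + triangle (j + 1) - triangle (j + 1 - l) ..<
      k_min j + triangle (j + 1) - triangle (j - l)}"

text \<open>The intervals \<open>label_interval j l\<close> with \<open>l \<le> j\<close> partition the positive naturals, so for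
  \<open>k \<ge> 1\<close> there is exactly one such value.\<close>

definition mbar_har :: "nat \<Rightarrow> nat" where
  "mbar_har k = (THE m. \<exists>j l. l \<le> j \<and> k \<in> label_interval j l \<and> m = label_mult 3 har (k_min j) + l)"

lemma incseq_subseq_nat:
  fixes u :: "nat \<Rightarrow> nat"
  shows "\<exists>r. strict_mono r \<and> incseq (u \<circ> r)"
proof -
  obtain f where f: "strict_mono f" "monoseq (\<lambda>n. u (f n))"
    using seq_monosub by blast
  show ?thesis
  proof (cases "incseq (\<lambda>n. u (f n))")
    case True
    then show ?thesis using f by (auto simp: comp_def)
  next
    case False
    then have d: "decseq (\<lambda>n. u (f n))" using f(2) monoseq_iff by blast
    define m where "m = (LEAST v. v \<in> range (\<lambda>n. u (f n)))"
    have "m \<in> range (\<lambda>n. u (f n))" unfolding m_def by (rule LeastI[of _ "u (f 0)"]) auto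
    then obtain p where p: "u (f p) = m" by auto
    have "u (f (p + n)) = m" for n
    proof (rule antisym)
      show "u (f (p + n)) \<le> m" using d p by (metis decseqD le_add1)
      show "m \<le> u (f (p + n))" unfolding m_def by (rule Least_le) auto
    qed
    then have "incseq (u \<circ> (\<lambda>n. f (p + n)))" by (auto simp: incseq_def)
    moreover have "strict_mono (\<lambda>n. f (p + n))" using f(1) by (auto simp: strict_mono_def)
    ultimately show ?thesis by blast
  qed
qed

lemma incseq_subseq_tuples:
  fixes t :: "nat \<Rightarrow> 'a \<Rightarrow> nat"
  assumes "finite S"
  shows "\<exists>r. strict_mono r \<and> (\<forall>n\<in>S. incseq (\<lambda>i. t (r i) n))"
  using assms
proof (induction S rule: finite_induct)
  case empty
  show ?case by (rule exI[of _ id]) (simp add: strict_mono_def)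
next
  case (insert x F)
  then obtain r where r: "strict_mono r" "\<forall>n\<in>F. incseq (\<lambda>i. t (r i) n)" by blast
  obtain q where q: "strict_mono q" "incseq ((\<lambda>i. t (r i) x) \<circ> q)"
    using incseq_subseq_nat by blast
  have "strict_mono (r \<circ> q)" using r(1) q(1) by (rule strict_mono_o)
  moreover have "incseq (\<lambda>i. t ((r \<circ> q) i) n)" if "n \<in> insert x F" for n
  proof (cases "n = x")
    case True
    then show ?thesis using q(2) by (simp add: comp_def)
  next
    case False
    then have "incseq (\<lambda>i. t (r i) n)" using r(2) that by auto
    moreover have "mono q" using q(1) by (rule strict_mono_mono)
    ultimately show ?thesis by (auto simp: incseq_def mono_def)
  qed
  ultimately show ?case by blast
qed

lemma no_descending_tuples:
  assumes a: "a \<in> arrays N" and t: "\<And>i. t i \<in> tuples N" and inj: "inj t"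
    and d: "decseq (\<lambda>i. tuple_sum N a (t i))"
  shows False
proof -
  obtain r where r: "strict_mono r" "\<forall>n\<in>{1..N}. incseq (\<lambda>i. t (r i) n)"
    using incseq_subseq_tuples[of "{1..N}" t] by blast
  define u v where "u = t (r 0)" and "v = t (r 1)"
  have u: "u \<in> tuples N" and v: "v \<in> tuples N" using t by (auto simp: u_def v_def)
  have r01: "r 0 < r 1" using r(1) by (simp add: strict_mono_def)
  have ne: "u \<noteq> v" using injD[OF inj, of "r 0" "r 1"] r01 by (auto simp: u_def v_def)
  have le: "u n \<le> v n" if "n \<in> {1..N}" for n
    using r(2) that by (auto simp: u_def v_def incseq_def)
  have mono: "a n (u n) \<le> a n (v n)" if "n \<in> {1..N}" for n
  proof (rule strict_mono_on_leD[of "{1..}" "a n"])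
    show "strict_mono_on {1..} (a n)" using a that by (simp add: arrays_def)
  qed (use u v le that in \<open>auto simp: tuples_def\<close>)
  obtain n where n: "n \<in> {1..N}" "u n \<noteq> v n"
    using ne u v unfolding tuples_def by (meson PiE_ext)
  have "a n (u n) < a n (v n)"
  proof (rule strict_mono_onD[of "{1..}" "a n"])
    show "strict_mono_on {1..} (a n)" using a n by (simp add: arrays_def)
    show "u n \<in> {1..}" "v n \<in> {1..}" using u v n(1) unfolding tuples_def by auto
    show "u n < v n" using n(2) le[OF n(1)] by simp
  qed
  then have "tuple_sum N a u < tuple_sum N a v"
    unfolding tuple_sum_def using n(1) mono by (intro sum_strict_mono_ex1) auto
  moreover have "tuple_sum N a v \<le> tuple_sum N a u"
    using decseqD[OF d less_imp_le[OF r01]] by (simp add: u_def v_def)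
  ultimately show False by simp
qed

lemma finite_level:
  assumes "a \<in> arrays N"
  shows "finite {j \<in> tuples N. tuple_sum N a j = x}"
proof (rule ccontr)
  assume "infinite {j \<in> tuples N. tuple_sum N a j = x}"
  then obtain t :: "nat \<Rightarrow> _" where t: "inj t" "range t \<subseteq> {j \<in> tuples N. tuple_sum N a j = x}"
    using infinite_countable_subset by blast
  then have "t i \<in> tuples N" "tuple_sum N a (t i) = x" for i by blast+
  then show False using no_descending_tuples[OF assms, of t] t(1) by (simp add: decseq_def)
qed

lemma ex_minimal_tuple:
  assumes a: "a \<in> arrays N" and X: "X \<subseteq> tuples N" "X \<noteq> {}"
  shows "\<exists>j\<in>X. \<forall>i\<in>X. tuple_sum N a j \<le> tuple_sum N a i"
proof -
  let ?R = "{(x, y). x \<in> tuples N \<and> y \<in> tuples N \<and> tuple_sum N a x < tuple_sum N a y}"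
  have "wf ?R"
    unfolding wf_iff_no_infinite_down_chain
  proof
    assume "\<exists>f. \<forall>i. (f (Suc i), f i) \<in> ?R"
    then obtain f where f: "\<And>i. (f (Suc i), f i) \<in> ?R" by blast
    have lt: "tuple_sum N a (f j) < tuple_sum N a (f i)" if "i < j" for i j
      using that
    proof (induction j rule: less_induct)
      case (less j)
      then obtain p where p: "j = Suc p" by (cases j) auto
      have "tuple_sum N a (f j) < tuple_sum N a (f p)" using f[of p] p by auto
      then show ?case using less.IH[of p] less.prems p by (cases "i = p") auto
    qed
    have "inj f"
    proof (rule injI)
      fix x y assume "f x = f y"
      then show "x = y" using lt[of x y] lt[of y x] by (cases x y rule: linorder_cases) auto
    qed
    moreover have "decseq (\<lambda>i. tuple_sum N a (f i))"
      unfolding decseq_def using lt by (metis le_less order.refl less_imp_le)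
    ultimately show False using no_descending_tuples[OF a, of f] f by auto
  qed
  then obtain z where z: "z \<in> X" "\<And>y. (y, z) \<in> ?R \<Longrightarrow> y \<notin> X"
    using X(2) wfE_min'[of ?R X] by blast
  have "tuple_sum N a z \<le> tuple_sum N a i" if "i \<in> X" for i
  proof (rule ccontr)
    assume "\<not> tuple_sum N a z \<le> tuple_sum N a i"
    then have "(i, z) \<in> ?R" using z(1) that X(1) by auto
    then show False using z(2) that by blast
  qed
  then show ?thesis using z(1) by blast
qed

lemma infinite_tuples:
  assumes "N \<ge> 1"
  shows "infinite (tuples N)"
proof
  assume fin: "finite (tuples N)"
  let ?g = "\<lambda>i::nat. \<lambda>n\<in>{1..N}. Suc i"
  have "inj ?g" using assms by (auto simp: inj_def fun_eq_iff restrict_def split: if_splits)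
  moreover have "range ?g \<subseteq> tuples N" by (auto simp: tuples_def)
  ultimately show False using fin by (metis finite_imageD finite_subset infinite_UNIV_nat)
qed

lemma ordered_spectrum_exists:
  assumes a: "a \<in> arrays N" and N: "N \<ge> 1"
  shows "\<exists>s. ordered_spectrum N a s"
proof -
  let ?f = "tuple_sum N a"
  define pick where "pick X = (SOME j. j \<in> tuples N - X \<and> (\<forall>i \<in> tuples N - X. ?f j \<le> ?f i))" for X
  have pick: "pick X \<in> tuples N - X" "\<And>i. i \<in> tuples N - X \<Longrightarrow> ?f (pick X) \<le> ?f i"
    if "finite X" for X
  proof -
    have "tuples N - X \<noteq> {}" using infinite_tuples[OF N] that by (metis finite.emptyI Diff_infinite_finite)
    then have "\<exists>j. j \<in> tuples N - X \<and> (\<forall>i \<in> tuples N - X. ?f j \<le> ?f i)"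
      using ex_minimal_tuple[OF a, of "tuples N - X"] by blast
    from someI_ex[OF this] show "pick X \<in> tuples N - X" "\<And>i. i \<in> tuples N - X \<Longrightarrow> ?f (pick X) \<le> ?f i"
      unfolding pick_def by blast+
  qed
  define P where "P = rec_nat {} (\<lambda>_ X. insert (pick X) X)"
  have P0: "P 0 = {}" and PS: "\<And>n. P (Suc n) = insert (pick (P n)) (P n)"
    by (simp_all add: P_def)
  have finP: "finite (P n)" for n by (induction n) (auto simp: P0 PS)
  have Pmono: "P m \<subseteq> P n" if "m \<le> n" for m n
    using that by (rule lift_Suc_mono_le[rotated]) (auto simp: PS)
  define t where "t n = pick (P n)" for n
  have tT: "t n \<in> tuples N" and tP: "t n \<notin> P n" for n using pick(1)[OF finP] by (auto simp: t_def)
  have tin: "t m \<in> P n" if "m < n" for m n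
    using Pmono[of "Suc m" n] that by (auto simp: PS t_def)
  have inj: "inj t"
  proof (rule injI)
    fix x y assume "t x = t y"
    then show "x = y" using tin[of x y] tin[of y x] tP[of x] tP[of y] by (cases x y rule: linorder_cases) auto
  qed
  have mono: "?f (t m) \<le> ?f (t n)" if "m \<le> n" for m n
    using pick(2)[OF finP, of "t n" m] tT tP Pmono[OF that] by (auto simp: t_def)
  have Pt: "P n = t ` {..<n}" for n
    by (induction n) (auto simp: P0 PS t_def lessThan_Suc)
  have below: "j \<in> range t" if j: "j \<in> tuples N" and le: "?f j \<le> ?f (t n)" for j n
  proof (rule ccontr)
    assume nj: "j \<notin> range t"
    have *: "?f (t m) \<le> ?f j" for m
      unfolding t_def by (rule pick(2)[OF finP]) (use j nj in \<open>auto simp: Pt\<close>)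
    have "?f (t m) = ?f j" if "m \<ge> n" for m
      using *[of m] le mono[OF that] by simp
    then have "t ` {n..} \<subseteq> {i \<in> tuples N. ?f i = ?f j}" using tT by auto
    then have "finite (t ` {n..})" using finite_level[OF a] finite_subset by blast
    then have "finite {n..}" using inj by (meson finite_imageD inj_on_subset subset_UNIV)
    then show False using infinite_Ici by blast
  qed
  define s where "s k = ?f (t (k - 1))" for k :: nat
  have "mono_on {1..} s" by (rule mono_onI) (auto simp: s_def intro!: mono)
  moreover have "s ` {1..} \<subseteq> spectrum N a" using tT by (auto simp: s_def spectrum_def)
  moreover have "card {k \<in> {1..}. s k = x} = multiplicity N a x" if x: "x \<in> s ` {1..}" for x
  proof -
    have "bij_betw (\<lambda>k. t (k - 1)) {k \<in> {1..}. s k = x} {j \<in> tuples N. ?f j = x}"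
      unfolding bij_betw_def
    proof
      show "inj_on (\<lambda>k. t (k - 1)) {k \<in> {1..}. s k = x}"
        by (rule inj_onI) (use injD[OF inj] in fastforce)
      show "(\<lambda>k. t (k - 1)) ` {k \<in> {1..}. s k = x} = {j \<in> tuples N. ?f j = x}"
      proof (intro equalityI subsetI)
        fix j assume j: "j \<in> {j \<in> tuples N. ?f j = x}"
        obtain k where "x = ?f (t (k - 1))" using x by (auto simp: s_def)
        then obtain n where n: "j = t n" using below[of j "k - 1"] j by auto
        then have "Suc n \<in> {k \<in> {1..}. s k = x}" using j by (auto simp: s_def)
        moreover have "j = t (Suc n - 1)" using n by simp
        ultimately show "j \<in> (\<lambda>k. t (k - 1)) ` {k \<in> {1..}. s k = x}" by blast
      qed (use tT in \<open>auto simp: s_def\<close>)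
    qed
    then show ?thesis unfolding multiplicity_def by (rule bij_betw_same_card)
  qed
  moreover have "s k < x" if x: "x \<in> spectrum N a - s ` {1..}" and "k \<ge> 1" for x k
  proof (rule ccontr)
    assume "\<not> s k < x"
    moreover obtain j where j: "j \<in> tuples N" "x = ?f j" using x by (auto simp: spectrum_def)
    ultimately obtain n where "j = t n" using below[of j "k - 1"] by (auto simp: s_def)
    then have "x = s (Suc n)" using j by (simp add: s_def)
    then show False using x by auto
  qed
  ultimately show ?thesis unfolding ordered_spectrum_def by blast
qed

lemma ordered_spectrum_step:
  assumes s: "ordered_spectrum N a s" and s': "ordered_spectrum N a s'"
    and k: "k \<ge> 1" and eq: "\<And>i. 1 \<le> i \<Longrightarrow> i < k \<Longrightarrow> s i = s' i"
  shows "s' k \<le> s k"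
proof (rule ccontr)
  assume "\<not> s' k \<le> s k"
  then have lt: "s k < s' k" by simp
  define x where "x = s k"
  have xs: "x \<in> s ` {1..}" using k by (simp add: x_def)
  have "x \<in> spectrum N a" using s xs by (auto simp: ordered_spectrum_def)
  then have xs': "x \<in> s' ` {1..}"
    using s' k lt unfolding ordered_spectrum_def x_def by (meson DiffI less_asym)
  let ?A = "{i \<in> {1..}. s i = x}" and ?A' = "{i \<in> {1..}. s' i = x}"
  have card: "card ?A = card ?A'" using s s' xs xs' unfolding ordered_spectrum_def by metis
  have mono: "mono_on {1..} s'" using s' by (simp add: ordered_spectrum_def)
  have less: "i < k" if "i \<in> ?A'" for i
  proof (rule ccontr)
    assume "\<not> i < k"
    then have "s' k \<le> s' i" using mono_onD[OF mono, of k i] k by auto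
    then show False using that lt by (auto simp: x_def)
  qed
  have fin': "finite ?A'" by (rule finite_subset[of _ "{..<k}"]) (use less in auto)
  moreover have "?A' \<noteq> {}" using xs' by auto
  ultimately have "finite ?A" using card by (metis card_gt_0_iff)
  moreover have "?A' \<subset> ?A"
  proof
    show "?A' \<subseteq> ?A" using less eq by auto
    have "k \<in> ?A" using k by (simp add: x_def)
    then show "?A' \<noteq> ?A" using less by blast
  qed
  ultimately have "card ?A' < card ?A" by (rule psubset_card_mono)
  then show False using card by simp
qed

lemma ordered_spectrum_unique:
  assumes s: "ordered_spectrum N a s" and s': "ordered_spectrum N a s'" and "k \<ge> 1"
  shows "s k = s' k"
  using \<open>k \<ge> 1\<close>
proof (induction k rule: less_induct)
  case (less k)
  have "s' k \<le> s k" by (rule ordered_spectrum_step[OF s s']) (use less in auto)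
  moreover have "s k \<le> s' k" by (rule ordered_spectrum_step[OF s' s]) (use less in auto)
  ultimately show ?case by simp
qed

lemma eigenvalue_eq:
  assumes "ordered_spectrum N a s" "k \<ge> 1"
  shows "eigenvalue N a k = s k"
  unfolding eigenvalue_def
proof (rule the_equality)
  show "\<exists>s'. ordered_spectrum N a s' \<and> s k = s' k" using assms by blast
next
  fix x assume "\<exists>s'. ordered_spectrum N a s' \<and> x = s' k"
  then show "x = s k" using ordered_spectrum_unique[OF assms(1) _ assms(2)] by auto
qed

end

theory Submission
  imports Defs
begin

text \<open>
  For \<open>k \<in> I\<^sub>j\<^sub>,\<^sub>l\<close> the witness keeps two harmonic rows and replaces the third one by
  \<open>-1, 0, 1, 2, \<dots>\<close> with the entry \<open>l - 1\<close> removed. Prepending \<open>-1\<close> adds \<open>j + 2\<close> representations of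
  \<open>j\<close> and \<open>c(j + 1)\<close> tuples below \<open>j\<close>; removing \<open>l - 1\<close> takes away \<open>j + 2 - l\<close> and \<open>c(j + 1 - l)\<close> of
  them. Hence \<open>j\<close> has multiplicity \<open>(j + 1)(j + 2)/2 + l\<close>, and its smallest label is exactly the
  left end of \<open>I\<^sub>j\<^sub>,\<^sub>l\<close>. For \<open>l = 0\<close> the array is the harmonic one.
\<close>

section \<open>Labels of an eigenvalue\<close>

lemma spectrum_iff_multiplicity:
  assumes "a \<in> arrays N"
  shows "x \<in> spectrum N a \<longleftrightarrow> 0 < multiplicity N a x"
  using finite_level[OF assms, of x] by (auto simp: spectrum_def multiplicity_def card_gt_0_iff)

lemma initial_segment_eq:
  fixes A :: "nat set"
  assumes "finite A" "A \<subseteq> {1..}" and down: "\<And>i k. k \<in> A \<Longrightarrow> 1 \<le> i \<Longrightarrow> i \<le> k \<Longrightarrow> i \<in> A"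
  shows "A = {1..card A}"
proof (cases "A = {}")
  case False
  then have "Max A \<in> A" using assms(1) by (rule Max_in[rotated])
  then have "A = {1..Max A}"
    using assms(2) Max_ge[OF assms(1)] down[of "Max A"] by fastforce
  then show ?thesis by (metis card_atLeastAtMost diff_Suc_1)
qed simp

text \<open>As \<open>L\<close> tuples have sum below \<open>x\<close>, the labels of
  \<open>x\<close> form the block of length \<open>multiplicity N a x\<close> right after
  \<open>L\<close>. Finiteness of \<open>L\<close>'s set ensures that \<open>x\<close> is among the
  first \<omega> values, even when rows are bounded.\<close>

lemma eigenvalue_eq_iff:
  assumes a: "a \<in> arrays N" and N: "N \<ge> 1" and x: "x \<in> spectrum N a" and k: "k \<ge> 1"
    and fin: "finite {j \<in> tuples N. tuple_sum N a j < x}"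
  defines "L \<equiv> card {j \<in> tuples N. tuple_sum N a j < x}"
  shows "eigenvalue N a k = x \<longleftrightarrow> L < k \<and> k \<le> L + multiplicity N a x"
proof -
  obtain s where s: "ordered_spectrum N a s" using ordered_spectrum_exists[OF a N] by blast
  have mono_s: "mono_on {1..} s" and sub_s: "s ` {1..} \<subseteq> spectrum N a"
    and fibre_s: "\<forall>y \<in> s ` {1..}. card {k \<in> {1..}. s k = y} = multiplicity N a y"
    and above: "\<forall>y \<in> spectrum N a - s ` {1..}. \<forall>k\<ge>1. s k < y"
    using s unfolding ordered_spectrum_def by blast+
  have mono: "s i \<le> s k" if "1 \<le> i" "i \<le> k" for i k
    by (rule mono_onD[OF mono_s]) (use that in auto)
  have sub: "s i \<in> spectrum N a" if "i \<ge> 1" for i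
    using sub_s that by auto
  have fibre: "card {k \<in> {1..}. s k = y} = multiplicity N a y" if "y \<in> s ` {1..}" for y
    using fibre_s that by blast
  \<comment> \<open>An infinite set has \<open>card\<close> 0, so a positive multiplicity forces a
    finite fibre.\<close>
  have fin_fibre: "finite {k \<in> {1..}. s k = y}" if "y \<in> s ` {1..}" for y
    using fibre[OF that] that sub spectrum_iff_multiplicity[OF a] by (intro card_ge_0_finite) auto
  define Y where "Y = {y \<in> spectrum N a. y < x}"
  have "Y = tuple_sum N a ` {j \<in> tuples N. tuple_sum N a j < x}"
    by (auto simp: Y_def spectrum_def)
  then have finY: "finite Y" using fin by simp
  have below: "{k \<in> {1..}. s k < x} = (\<Union>y \<in> Y \<inter> s ` {1..}. {k \<in> {1..}. s k = y})"
    using sub by (auto simp: Y_def)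
  have fin_below: "finite {k \<in> {1..}. s k < x}"
    unfolding below using finY fin_fibre by auto
  \<comment> \<open>If \<open>x\<close> were never listed, every label would carry a value below
    \<open>x\<close>, contradicting \<open>fin_below\<close>.\<close>
  have ximg: "x \<in> s ` {1..}"
  proof (rule ccontr)
    assume "x \<notin> s ` {1..}"
    then have "{k \<in> {1..}. s k < x} = {1..}" using above x by fastforce
    then show False using fin_below infinite_Ici[of "1::nat"] by simp
  qed
  have Yimg: "Y \<subseteq> s ` {1..}"
  proof (rule subsetI, rule ccontr)
    fix y assume y: "y \<in> Y" "y \<notin> s ` {1..}"
    then have "\<forall>k\<ge>1. s k < y" using above by (auto simp: Y_def)
    then show False using ximg y(1) by (auto simp: Y_def)
  qed
  \<comment> \<open>Labels and tuples are compared fibre by fibre over the finitely many values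
    below \<open>x\<close>.\<close>
  have "card {k \<in> {1..}. s k < x} = (\<Sum>y\<in>Y. multiplicity N a y)"
    unfolding below Int_absorb2[OF Yimg] using finY Yimg fin_fibre fibre
    by (subst card_UN_disjoint) (auto intro!: sum.cong)
  also have "\<dots> = card (\<Union>y\<in>Y. {j \<in> tuples N. tuple_sum N a j = y})"
    unfolding multiplicity_def using finY finite_level[OF a] by (subst card_UN_disjoint) auto
  also have "(\<Union>y\<in>Y. {j \<in> tuples N. tuple_sum N a j = y}) = {j \<in> tuples N. tuple_sum N a j < x}"
    by (auto simp: Y_def spectrum_def)
  finally have cardL: "card {k \<in> {1..}. s k < x} = L" by (simp add: L_def)
  have le: "{k \<in> {1..}. s k \<le> x} = {k \<in> {1..}. s k < x} \<union> {k \<in> {1..}. s k = x}" by auto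
  have cardLE: "card {k \<in> {1..}. s k \<le> x} = L + multiplicity N a x"
    unfolding le using fin_below fin_fibre[OF ximg] cardL fibre[OF ximg]
    by (subst card_Un_disjoint) auto
  have "{k \<in> {1..}. s k < x} = {1..L}"
    unfolding cardL[symmetric] using fin_below mono
    by (intro initial_segment_eq) (auto intro: le_less_trans)
  from arg_cong[OF this, of "\<lambda>A. k \<in> A"] have "s k < x \<longleftrightarrow> k \<le> L" using k by simp
  moreover have "finite {k \<in> {1..}. s k \<le> x}" unfolding le using fin_below fin_fibre[OF ximg] by simp
  then have "{k \<in> {1..}. s k \<le> x} = {1..L + multiplicity N a x}"
    unfolding cardLE[symmetric] using mono
    by (intro initial_segment_eq) (auto intro: order_trans)
  from arg_cong[OF this, of "\<lambda>A. k \<in> A"] have "s k \<le> x \<longleftrightarrow> k \<le> L + multiplicity N a x"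
    using k by simp
  ultimately show ?thesis unfolding eigenvalue_eq[OF s k] by linarith
qed

section \<open>Counting lattice points\<close>

lemma triangle_0 [simp]: "triangle 0 = 0"
  by (simp add: triangle_def)

lemma triangle_Suc [simp]: "triangle (Suc n) = triangle n + Suc n"
  by (simp add: triangle_def)

lemma le_triangle: "n \<le> triangle n"
  by (induction n) auto

lemma triangle_mono: "m \<le> n \<Longrightarrow> triangle m \<le> triangle n"
  by (rule lift_Suc_mono_le[of triangle]) auto

text \<open>The tetrahedral number n(n+1)(n+2)/6: the number of triples of naturals with sum below
  \<open>n\<close>.\<close>

definition tetra :: "nat \<Rightarrow> nat" where
  "tetra n = (\<Sum>m<n. triangle (Suc m))"

lemma tetra_0 [simp]: "tetra 0 = 0"
  by (simp add: tetra_def)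

lemma tetra_Suc [simp]: "tetra (Suc n) = tetra n + triangle (Suc n)"
  by (simp add: tetra_def)

lemma triangle_le_tetra: "triangle n \<le> tetra n"
  by (cases n) auto

lemma sum_triangle: "(\<Sum>w\<le>n. Suc (n - w)) = triangle (Suc n)"
  by (induction n) (simp_all add: sum.atMost_Suc_shift del: sum.atMost_Suc)

text \<open>Shifting the third row by one keeps coordinates natural: the new entry -1 is
  \<open>w = 0\<close>, the removed entry is \<open>w = l\<close>, and level \<open>n\<close> holds
  the tuples with sum \<open>n - 1\<close>.\<close>

definition level :: "nat \<Rightarrow> nat \<Rightarrow> (nat \<times> nat \<times> nat) set" where
  "level l n = {(w, p, q). w \<noteq> l \<and> w + p + q = n}"

lemma level_eq_image:
  "level l n = (\<lambda>(w, p). (w, p, n - w - p)) ` (SIGMA w:{..n} - {l}. {..n - w})"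
  by (force simp: level_def image_iff)

lemma finite_level_set: "finite (level l n)"
  unfolding level_eq_image by simp

text \<open>The plane \<open>w = l\<close> meets the simplex in \<open>Suc n - l\<close> points; for
  \<open>l > n\<close> truncation gives the correct 0.\<close>

lemma card_level: "card (level l n) = triangle (Suc n) - (Suc n - l)"
proof -
  have "card (level l n) = card (SIGMA w:{..n} - {l}. {..n - w})"
    unfolding level_eq_image by (rule card_image) (auto simp: inj_on_def)
  also have "\<dots> = (\<Sum>w\<in>{..n} - {l}. Suc (n - w))" by simp
  also have "\<dots> = (\<Sum>w\<le>n. Suc (n - w)) - (Suc n - l)"
    by (cases "l \<le> n") (auto simp: sum_diff1_nat Suc_diff_le)
  finally show ?thesis by (simp only: sum_triangle)
qed

text \<open>The points lost to the gap are the pairs with \<open>p + q < n - l\<close>, a triangular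
  number of them.\<close>

lemma sum_card_level: "(\<Sum>m<n. card (level l m)) = tetra n - triangle (n - l)"
proof (induction n)
  case (Suc n)
  \<comment> \<open>These bounds keep the natural subtractions exact, so that they add up.\<close>
  have "triangle (n - l) \<le> tetra n"
    using triangle_mono[of "n - l" n] triangle_le_tetra[of n] by simp
  moreover have "Suc n - l \<le> triangle (Suc n)" using le_triangle[of "Suc n"] by simp
  moreover have "triangle (Suc n - l) = triangle (n - l) + (Suc n - l)"
    by (cases "l \<le> n") (auto simp: Suc_diff_le)
  ultimately show ?case using Suc by (simp add: card_level)
qed simp

section \<open>Harmonic rows with a gap\<close>

text \<open>Lowering the first \<open>l\<close> entries of the third row by one yields -1, ..., l -
  2, l, l + 1, ..., so the new entry and the gap arise together.\<close>

definition gap_array :: "nat \<Rightarrow> nat \<Rightarrow> nat \<Rightarrow> real" where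
  "gap_array l n i = har n i - of_bool (n = 3 \<and> i \<in> {1..l})"

lemma gap_array_0: "gap_array 0 = har"
  by (simp add: fun_eq_iff gap_array_def)

lemma gap_array_in_arrays: "gap_array l \<in> arrays N"
  by (auto simp: arrays_def gap_array_def har_def intro!: strict_mono_onI)

text \<open>The coordinate \<open>w\<close> is one more than the chosen entry of the third row.\<close>

definition gap_tuple :: "nat \<Rightarrow> nat \<times> nat \<times> nat \<Rightarrow> nat \<Rightarrow> nat" where
  "gap_tuple l = (\<lambda>(w, p, q). \<lambda>n\<in>{1..3}.
     if n = 1 then Suc p else if n = 2 then Suc q else if w < l then Suc w else w)"

lemma tuple_sum_3: "tuple_sum 3 a j = a 1 (j 1) + a 2 (j 2) + a 3 (j 3)"
  by (simp add: tuple_sum_def numeral_3_eq_3 numeral_2_eq_2)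

lemma tuple_sum_gap_tuple:
  "w \<noteq> l \<Longrightarrow> tuple_sum 3 (gap_array l) (gap_tuple l (w, p, q)) = real (w + p + q) - 1"
  by (auto simp: tuple_sum_3 gap_array_def gap_tuple_def har_def)

lemma bij_betw_gap_tuple: "bij_betw (gap_tuple l) {(w, p, q). w \<noteq> l} (tuples 3)"
proof -
  \<comment> \<open>Column \<open>c\<close> of the third row corresponds to \<open>w = c - 1\<close>
    up to the gap and to \<open>w = c\<close> beyond it, so exactly \<open>w = l\<close> is
    skipped.\<close>
  let ?inv = "\<lambda>j. (if j 3 \<le> l then j 3 - 1 else j 3, j 1 - 1, j 2 - 1 :: nat)"
  have three: "n = 1 \<or> n = 2 \<or> n = 3" if "n \<in> {1..3}" for n :: nat using that by auto
  show ?thesis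
  proof (rule bij_betw_byWitness[where f' = ?inv])
    show "\<forall>j\<in>tuples 3. gap_tuple l (?inv j) = j"
    proof
      fix j assume j: "j \<in> tuples 3"
      have pos: "1 \<le> j 1" "1 \<le> j 2" "1 \<le> j 3" using j by (auto simp: tuples_def PiE_iff)
      show "gap_tuple l (?inv j) = j"
      proof (rule PiE_ext)
        show "gap_tuple l (?inv j) \<in> {1..3} \<rightarrow>\<^sub>E UNIV" by (auto simp: gap_tuple_def)
        show "j \<in> {1..3} \<rightarrow>\<^sub>E UNIV" using j by (auto simp: tuples_def PiE_iff)
        show "gap_tuple l (?inv j) n = j n" if "n \<in> {1..3}" for n
          using three[OF that] pos by (auto simp: gap_tuple_def)
      qed
    qed
    show "?inv ` tuples 3 \<subseteq> {(w, p, q). w \<noteq> l}"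
    proof (rule image_subsetI)
      fix j assume "j \<in> tuples 3"
      then have "1 \<le> j 3" by (auto simp: tuples_def PiE_iff)
      then show "?inv j \<in> {(w, p, q). w \<noteq> l}" by auto
    qed
  qed (auto simp: gap_tuple_def tuples_def)
qed

text \<open>Leaving \<open>P\<close> abstract serves both the tuples with sum equal to
  \<open>m\<close> and those with sum below \<open>m\<close>.\<close>

lemma gap_tuple_image_Collect:
  assumes "\<And>w p q. w \<noteq> l \<Longrightarrow> P (real (w + p + q) - 1) \<longleftrightarrow> (w, p, q) \<in> S"
  shows "{j \<in> tuples 3. P (tuple_sum 3 (gap_array l) j)} = gap_tuple l ` {t \<in> S. fst t \<noteq> l}"
  unfolding bij_betw_imp_surj_on[OF bij_betw_gap_tuple, of l, symmetric]
  using assms by (force simp: tuple_sum_gap_tuple)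

lemma inj_on_gap_tuple: "inj_on (gap_tuple l) {t \<in> S. fst t \<noteq> l}"
  by (rule inj_on_subset[OF bij_betw_imp_inj_on[OF bij_betw_gap_tuple]]) auto

lemma gap_array_level:
  "{j \<in> tuples 3. tuple_sum 3 (gap_array l) j = real m} = gap_tuple l ` level l (Suc m)"
proof -
  have "{t \<in> level l (Suc m). fst t \<noteq> l} = level l (Suc m)" by (auto simp: level_def)
  moreover have "real (w + p + q) - 1 = real m \<longleftrightarrow> w + p + q = Suc m" for w p q by linarith
  ultimately show ?thesis
    using gap_tuple_image_Collect[of l "\<lambda>x. x = real m" "level l (Suc m)"]
    by (simp add: level_def)
qed

lemma gap_array_below:
  "{j \<in> tuples 3. tuple_sum 3 (gap_array l) j < real m} = gap_tuple l ` (\<Union>n<Suc m. level l n)"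
proof -
  have "{t \<in> \<Union>n<Suc m. level l n. fst t \<noteq> l} = (\<Union>n<Suc m. level l n)" by (auto simp: level_def)
  moreover have "real (w + p + q) - 1 < real m \<longleftrightarrow> w + p + q < Suc m" for w p q by linarith
  ultimately show ?thesis
    using gap_tuple_image_Collect[of l "\<lambda>x. x < real m" "\<Union>n<Suc m. level l n"]
    by (simp add: level_def)
qed

lemma inj_on_gap_tuple_level: "inj_on (gap_tuple l) (\<Union>n\<in>A. level l n)"
  by (rule inj_on_subset[OF inj_on_gap_tuple[of l UNIV]]) (auto simp: level_def)

lemma multiplicity_gap_array:
  assumes "l \<le> m"
  shows "multiplicity 3 (gap_array l) (real m) = triangle (Suc m) + l"
proof -
  have "inj_on (gap_tuple l) (level l (Suc m))"
    using inj_on_gap_tuple_level[of l "{Suc m}"] by simp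
  then have "multiplicity 3 (gap_array l) (real m) = card (level l (Suc m))"
    unfolding multiplicity_def gap_array_level by (rule card_image)
  then show ?thesis using assms by (simp add: card_level)
qed

lemma finite_gap_array_below:
  "finite {j \<in> tuples 3. tuple_sum 3 (gap_array l) j < real m}"
  unfolding gap_array_below using finite_level_set by blast

lemma card_gap_array_below:
  "card {j \<in> tuples 3. tuple_sum 3 (gap_array l) j < real m} = tetra (Suc m) - triangle (Suc m - l)"
proof -
  have "card {j \<in> tuples 3. tuple_sum 3 (gap_array l) j < real m} = card (\<Union>n<Suc m. level l n)"
    unfolding gap_array_below by (rule card_image[OF inj_on_gap_tuple_level])
  also have "\<dots> = (\<Sum>n<Suc m. card (level l n))"
    using finite_level_set by (intro card_UN_disjoint) (auto simp: level_def)
  finally show ?thesis by (simp only: sum_card_level)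
qed

lemma eigenvalue_gap_array_iff:
  assumes "l \<le> m" "k \<ge> 1"
  shows "eigenvalue 3 (gap_array l) k = real m \<longleftrightarrow>
    tetra (Suc m) - triangle (Suc m - l) < k \<and>
    k \<le> tetra (Suc m) - triangle (Suc m - l) + (triangle (Suc m) + l)"
proof -
  have "real m \<in> spectrum 3 (gap_array l)"
    unfolding spectrum_iff_multiplicity[OF gap_array_in_arrays] multiplicity_gap_array[OF assms(1)]
    by simp
  from eigenvalue_eq_iff[OF gap_array_in_arrays _ this assms(2) finite_gap_array_below]
  show ?thesis by (simp only: card_gap_array_below multiplicity_gap_array[OF assms(1)])
qed

lemma eigenvalue_har_iff:
  assumes "k \<ge> 1"
  shows "eigenvalue 3 har k = real m \<longleftrightarrow> tetra m < k \<and> k \<le> tetra (Suc m)"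
  using eigenvalue_gap_array_iff[of 0 m k] assms by (simp add: gap_array_0)

lemma k_min_eq: "k_min j = Suc (tetra j)"
  unfolding k_min_def by (rule Least_equality) (auto simp: eigenvalue_har_iff)

lemma label_mult_har_k_min: "label_mult 3 har (k_min j) = triangle (Suc j)"
proof -
  have "eigenvalue 3 har (k_min j) = real j" by (simp add: eigenvalue_har_iff k_min_eq)
  then show ?thesis using multiplicity_gap_array[of 0 j] by (simp add: label_mult_def gap_array_0)
qed

section \<open>The label intervals\<close>

text \<open>Together with \<open>step_exists\<close> this locates \<open>k\<close> between
  consecutive breakpoints, first among the blocks of \<open>j\<close>, then among the intervals of
  one block.\<close>

lemma step_unique:
  fixes f :: "nat \<Rightarrow> nat"
  assumes "mono f" "f i \<le> k" "k < f (Suc i)" "f j \<le> k" "k < f (Suc j)"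
  shows "i = j"
proof (rule ccontr)
  assume "i \<noteq> j"
  then have "Suc i \<le> j \<or> Suc j \<le> i" by auto
  then show False using monoD[OF assms(1)] assms(2-) by (meson leD order_trans)
qed

lemma step_exists:
  fixes f :: "nat \<Rightarrow> nat"
  assumes "f 0 \<le> k" "k < f n"
  shows "\<exists>i<n. f i \<le> k \<and> k < f (Suc i)"
  using assms(2)
proof (induction n)
  case (Suc n)
  then show ?case by (cases "k < f n") (auto intro: less_SucI)
qed (use assms(1) in simp)

text \<open>Here \<open>k_min j + triangle (j + 1)\<close> is collapsed to
  \<open>Suc (tetra (Suc j))\<close>. The value is also one more than the number of tuples of
  \<open>gap_array l\<close> with sum below \<open>j\<close>.\<close>

definition label_start :: "nat \<Rightarrow> nat \<Rightarrow> nat" where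
  "label_start j l = Suc (tetra (Suc j)) - triangle (Suc j - l)"

lemma label_interval_eq: "label_interval j l = {label_start j l..<label_start j (Suc l)}"
  by (simp add: label_interval_def label_start_def k_min_eq)

lemma label_start_0: "label_start j 0 = Suc (tetra j)"
  by (simp add: label_start_def)

lemma label_start_Suc: "label_start j (Suc j) = Suc (tetra (Suc j))"
  by (simp add: label_start_def)

lemma mono_label_start: "mono (label_start j)"
  unfolding label_start_def by (intro monoI diff_le_mono2 triangle_mono) auto

lemma le_tetra: "n \<le> tetra n"
  using le_triangle[of n] triangle_le_tetra[of n] by simp

lemma mono_tetra: "mono tetra"
  by (rule mono_iff_le_Suc[THEN iffD2]) simp

lemma label_interval_exists:
  assumes "k \<ge> 1"
  shows "\<exists>j l. l \<le> j \<and> k \<in> label_interval j l"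
proof -
  have "k < Suc (tetra k)" using le_tetra[of k] by simp
  then obtain j where "Suc (tetra j) \<le> k" "k < Suc (tetra (Suc j))"
    using step_exists[of "\<lambda>j. Suc (tetra j)" k k] assms by auto
  then obtain l where "l < Suc j" "label_start j l \<le> k" "k < label_start j (Suc l)"
    using step_exists[of "label_start j" k "Suc j"] by (auto simp: label_start_0 label_start_Suc)
  then show ?thesis unfolding label_interval_eq by (metis atLeastLessThan_iff less_Suc_eq_le)
qed

lemma label_interval_subset:
  assumes "l \<le> j"
  shows "label_interval j l \<subseteq> {Suc (tetra j)..<Suc (tetra (Suc j))}"
proof -
  have "label_start j 0 \<le> label_start j l" by (rule monoD[OF mono_label_start]) simp
  moreover have "label_start j (Suc l) \<le> label_start j (Suc j)"
    by (rule monoD[OF mono_label_start]) (use assms in simp)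
  ultimately show ?thesis
    unfolding label_interval_eq label_start_0 label_start_Suc ivl_subset by blast
qed

lemma label_interval_unique:
  assumes "l \<le> j" "k \<in> label_interval j l" "l' \<le> j'" "k \<in> label_interval j' l'"
  shows "j = j' \<and> l = l'"
proof
  have "mono (\<lambda>j. Suc (tetra j))" using mono_tetra by (simp add: mono_def)
  \<comment> \<open>Each interval lies in the block of its \<open>j\<close>, and these blocks are
    disjoint; so \<open>j\<close> is settled before \<open>l\<close>.\<close>
  then show j: "j = j'"
    using subsetD[OF label_interval_subset[OF assms(1)] assms(2)]
      subsetD[OF label_interval_subset[OF assms(3)] assms(4)]
    by (intro step_unique[of "\<lambda>j. Suc (tetra j)" _ k]) (simp_all del: tetra_Suc)
  show "l = l'"
    using assms(2,4) unfolding j label_interval_eq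
    by (intro step_unique[OF mono_label_start[of j'], of _ k]) simp_all
qed

lemma mbar_har_eq:
  assumes "l \<le> j" "k \<in> label_interval j l"
  shows "mbar_har k = triangle (Suc j) + l"
  unfolding mbar_har_def label_mult_har_k_min
proof (rule the_equality)
  show "\<exists>j' l'. l' \<le> j' \<and> k \<in> label_interval j' l' \<and> triangle (Suc j) + l = triangle (Suc j') + l'"
    using assms by blast
next
  fix m assume "\<exists>j' l'. l' \<le> j' \<and> k \<in> label_interval j' l' \<and> m = triangle (Suc j') + l'"
  then obtain j' l' where "l' \<le> j'" "k \<in> label_interval j' l'" "m = triangle (Suc j') + l'"
    by blast
  then show "m = triangle (Suc j) + l" using label_interval_unique[OF assms] by metis
qed

theorem theorem7p1:
  fixes k :: nat
  assumes "k \<ge> 1"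
  shows "max_mult k 3 \<ge> enat (mbar_har k)"
proof -
  obtain j l where jl: "l \<le> j" "k \<in> label_interval j l"
    using label_interval_exists[OF assms] by blast
  \<comment> \<open>The interval starts at the first label of eigenvalue \<open>j\<close> of
    \<open>gap_array l\<close>. Its length \<open>Suc j - l\<close> is at most
    \<open>triangle (Suc j)\<close>, hence at most the multiplicity, so all of it carries this
    eigenvalue.\<close>
  have "triangle (Suc j - l) \<le> tetra (Suc j)"
    using triangle_mono[of "Suc j - l" "Suc j"] triangle_le_tetra[of "Suc j"] by simp
  moreover have "triangle (Suc j - l) = triangle (j - l) + (Suc j - l)"
    using jl(1) by (simp add: Suc_diff_le)
  moreover have "Suc j \<le> triangle (Suc j)" by (rule le_triangle)
  ultimately have "eigenvalue 3 (gap_array l) k = real j"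
    unfolding eigenvalue_gap_array_iff[OF jl(1) assms]
    using jl unfolding label_interval_eq label_start_def atLeastLessThan_iff diff_Suc_Suc
    by linarith
  then have "label_mult 3 (gap_array l) k = mbar_har k"
    by (simp add: label_mult_def multiplicity_gap_array jl mbar_har_eq[OF jl])
  then show ?thesis
    unfolding max_mult_def by (metis SUP_upper gap_array_in_arrays)
qed

end
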